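(* Let $g\in\mathbb{R}^T$ be a WCSP and let $f\in\mathbb{R}^T$ be a super-reparametrization of $g$, i.e., $f$ is feasible for the optimization problem $$\min\{\,B(f')\mid f'\in\mathbb{R}^T \text{ is a super-reparametrization of } g\,\}. \qquad (\mathrm{P}_g)$$ The following are equivalent: (a) $f$ is optimal for $(\mathrm{P}_g)$. (b) $B(f)=\max_{x\in D^V}\langle f,\phi(x)\rangle=\max_{x\in D^V}\langle g,\phi(x)\rangle$. (c) The CSP $A^*(f)$ has a solution $x$ satisfying $\langle f,\phi(x)\rangle=\langle g,\phi(x)\rangle$.
   Context: Fix a structure $(D,V,C)$: $V$ is a finite set of variables, $D$ a finite nonempty domain, $C\subseteq 2^V$ a set of non-empty subsets of $V$ (scopes). For $S\subseteq V$, $D^S$ is the set of maps $S\to D$; for an assignment $x\in D^V$, $x[S]\in D^S$ is its restriction to $S$. Tuples: $T_S=\{(S,k)\mid k\in D^S\}$ for $S\in C$ and $T=\bigcup_{S\in C}T_S$. A CSP is a subset $A\subseteq T$ (of allowed tuples); $x\in D^V$ is a solution of $A$ if $(S,x[S])\in A$ for all $S\in C$. A WCSP is a vector $f\in\mathbb{R}^T$. The map $\phi\colon D^V\to\{0,1\}^T$ is defined by $\phi_{(S,k)}(x)=1$ if $x[S]=k$ and $0$ otherwise, so the WCSP objective is $\langle f,\phi(x)\rangle=\sum_{t\in T}f_t\phi_t(x)=\sum_{S\in C}f_{(S,x[S])}$. A WCSP $f$ is a super-reparametrization of $g$ if $\langle f,\phi(x)\rangle\ge\langle g,\phi(x)\rangle$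 for all $x\in D^V$. Upper bound: $B(f)=\sum_{S\in C}\max_{t\in T_S}f_t$. A tuple $t\in T_S$ is active for $f$ if $f_t=\max_{t'\in T_S}f_{t'}$; $A^*(f)\subseteq T$ is the set of all tuples active for $f$, viewed as a CSP. *)

theory Defs
  imports Complex_Main "HOL-Library.FuncSet"
begin

text \<open>Maps are represented extensionally: \<open>D\<^sup>S\<close> is \<open>S \<rightarrow>\<^sub>E D\<close>, the vector space \<open>\<real>\<^sup>T\<close>
  is \<open>T \<rightarrow>\<^sub>E UNIV\<close>, and \<open>x[S]\<close> is \<^term>\<open>restrict x S\<close>.\<close>

type_synonym ('v, 'd) tuple = "'v set \<times> ('v \<Rightarrow> 'd)"

definition scope_tuples :: "'d set \<Rightarrow> 'v set \<Rightarrow> ('v, 'd) tuple set" where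
  "scope_tuples D S = {(S, k) | k. k \<in> S \<rightarrow>\<^sub>E D}"

definition tuples :: "'d set \<Rightarrow> 'v set set \<Rightarrow> ('v, 'd) tuple set" where
  "tuples D C = (\<Union>S\<in>C. scope_tuples D S)"

definition csp_solution ::
  "'d set \<Rightarrow> 'v set \<Rightarrow> 'v set set \<Rightarrow> ('v, 'd) tuple set \<Rightarrow> ('v \<Rightarrow> 'd) \<Rightarrow> bool" where
  "csp_solution D V C A x \<longleftrightarrow> x \<in> V \<rightarrow>\<^sub>E D \<and> (\<forall>S\<in>C. (S, restrict x S) \<in> A)"

definition wcsps :: "'d set \<Rightarrow> 'v set set \<Rightarrow> (('v, 'd) tuple \<Rightarrow> real) set" where
  "wcsps D C = tuples D C \<rightarrow>\<^sub>E UNIV"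

definition phi :: "'d set \<Rightarrow> 'v set set \<Rightarrow> ('v \<Rightarrow> 'd) \<Rightarrow> ('v, 'd) tuple \<Rightarrow> real" where
  "phi D C x = (\<lambda>t\<in>tuples D C. if restrict x (fst t) = snd t then 1 else 0)"

definition objective ::
  "'d set \<Rightarrow> 'v set set \<Rightarrow> (('v, 'd) tuple \<Rightarrow> real) \<Rightarrow> ('v \<Rightarrow> 'd) \<Rightarrow> real" where
  "objective D C f x = (\<Sum>t\<in>tuples D C. f t * phi D C x t)"

definition super_reparametrization ::
  "'d set \<Rightarrow> 'v set \<Rightarrow> 'v set set \<Rightarrow> (('v, 'd) tuple \<Rightarrow> real) \<Rightarrow> (('v, 'd) tuple \<Rightarrow> real) \<Rightarrow> bool"
where
  "super_reparametrization D V C f g \<longleftrightarrow>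
     f \<in> wcsps D C \<and> g \<in> wcsps D C \<and>
     (\<forall>x \<in> V \<rightarrow>\<^sub>E D. objective D C f x \<ge> objective D C g x)"

definition upper_bound :: "'d set \<Rightarrow> 'v set set \<Rightarrow> (('v, 'd) tuple \<Rightarrow> real) \<Rightarrow> real" where
  "upper_bound D C f = (\<Sum>S\<in>C. Max (f ` scope_tuples D S))"

definition active_tuples ::
  "'d set \<Rightarrow> 'v set set \<Rightarrow> (('v, 'd) tuple \<Rightarrow> real) \<Rightarrow> ('v, 'd) tuple set" where
  "active_tuples D C f =
     {t. \<exists>S\<in>C. t \<in> scope_tuples D S \<and> f t = Max (f ` scope_tuples D S)}"

lemma objective_eq_sum_scopes:
  assumes "finite V" "finite D" "C \<subseteq> Pow V" "x \<in> V \<rightarrow>\<^sub>E D"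
  shows "objective D C f x = (\<Sum>S\<in>C. f (S, restrict x S))"
proof -
  have finC: "finite C"
    using assms(1,3) by (meson finite_Pow_iff finite_subset)
  have finS: "finite (S \<rightarrow>\<^sub>E D)" if "S \<in> C" for S
    using that assms(1-3) by (meson PowD finite_PiE finite_subset subsetD)
  have T: "tuples D C = Sigma C (\<lambda>S. S \<rightarrow>\<^sub>E D)"
    by (auto simp: tuples_def scope_tuples_def)
  have "objective D C f x =
      (\<Sum>t\<in>Sigma C (\<lambda>S. S \<rightarrow>\<^sub>E D). if restrict x (fst t) = snd t then f t else 0)"
    unfolding objective_def phi_def T by (intro sum.cong) auto
  also have "\<dots> = (\<Sum>S\<in>C. \<Sum>k\<in>S \<rightarrow>\<^sub>E D. if restrict x S = k then f (S, k) else 0)"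
    using finC finS by (subst sum.Sigma) (auto intro!: sum.cong)
  also have "\<dots> = (\<Sum>S\<in>C. f (S, restrict x S))"
  proof (rule sum.cong)
    fix S assume S: "S \<in> C"
    have "restrict x S \<in> S \<rightarrow>\<^sub>E D"
      using S assms(3,4) by (auto simp: PiE_iff)
    then show "(\<Sum>k\<in>S \<rightarrow>\<^sub>E D. if restrict x S = k then f (S, k) else 0) = f (S, restrict x S)"
      using finS[OF S] by simp
  qed simp
  finally show ?thesis .
qed

end

theory Submission
  imports Defs
begin

text \<open>
  For every super-reparametrization \<open>f\<close> of \<open>g\<close>, the bound \<open>B(f)\<close> is at least the maximum of the
  objective of \<open>f\<close>, which is at least the maximum \<open>M\<close> of the objective of \<open>g\<close>. The constant
  WCSP with entries \<open>M / |C|\<close> attains \<open>B = M\<close>, so \<open>M\<close> is the optimal value, and each of the three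
  conditions says that \<open>B(f) = M\<close>.
\<close>

lemma finite_scope_tuples:
  assumes "finite S" "finite D"
  shows "finite (scope_tuples D S)"
proof -
  have "scope_tuples D S = Pair S ` (S \<rightarrow>\<^sub>E D)"
    by (auto simp: scope_tuples_def)
  then show ?thesis
    using assms by (simp add: finite_PiE)
qed

lemma scope_tuples_nonempty:
  assumes "D \<noteq> {}"
  shows "scope_tuples D S \<noteq> {}"
  using assms by (auto simp: scope_tuples_def PiE_eq_empty_iff)

lemma restrict_in_scope_tuples:
  assumes "x \<in> V \<rightarrow>\<^sub>E D" "S \<subseteq> V"
  shows "(S, restrict x S) \<in> scope_tuples D S"
  using assms by (auto simp: scope_tuples_def PiE_iff)

lemma tuple_le_Max_scope:
  assumes "finite V" "finite D" "S \<subseteq> V" "x \<in> V \<rightarrow>\<^sub>E D"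
  shows "f (S, restrict x S) \<le> Max (f ` scope_tuples D S)"
  using assms finite_subset[OF assms(3,1)]
  by (intro Max_ge finite_imageI finite_scope_tuples imageI restrict_in_scope_tuples)

lemma objective_le_upper_bound:
  assumes "finite V" "finite D" "C \<subseteq> Pow V" "x \<in> V \<rightarrow>\<^sub>E D"
  shows "objective D C f x \<le> upper_bound D C f"
  unfolding objective_eq_sum_scopes[OF assms] upper_bound_def
  using assms by (intro sum_mono tuple_le_Max_scope) auto

text \<open>Objective and bound are sums over the same scopes, and each term of the first is at most
  the matching term of the second. Hence the sums agree exactly when every scope attains its maximum
  at \<open>restrict x S\<close>, that is, when every such tuple is active.\<close>

lemma csp_solution_active_iff:
  assumes "finite V" "finite D" "C \<subseteq> Pow V" "x \<in> V \<rightarrow>\<^sub>E D"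
  shows "csp_solution D V C (active_tuples D C f) x \<longleftrightarrow> objective D C f x = upper_bound D C f"
proof -
  have finC: "finite C"
    using assms(1,3) by (meson finite_Pow_iff finite_subset)
  have le: "\<forall>S\<in>C. f (S, restrict x S) \<le> Max (f ` scope_tuples D S)"
    using assms by (auto intro: tuple_le_Max_scope)
  \<comment> \<open>A tuple carries its scope as first component, so only \<open>S\<close> itself
    can witness the existential in \<open>active_tuples\<close>.\<close>
  have active: "(S, restrict x S) \<in> active_tuples D C f \<longleftrightarrow>
      f (S, restrict x S) = Max (f ` scope_tuples D S)" if "S \<in> C" for S
    using that assms(3) restrict_in_scope_tuples[OF assms(4), of S]
    by (auto simp: active_tuples_def scope_tuples_def)
  have "csp_solution D V C (active_tuples D C f) x \<longleftrightarrow>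
      (\<forall>S\<in>C. f (S, restrict x S) = Max (f ` scope_tuples D S))"
    using assms(4) active by (auto simp: csp_solution_def)
  also have "\<dots> \<longleftrightarrow> objective D C f x = upper_bound D C f"
    unfolding objective_eq_sum_scopes[OF assms] upper_bound_def
    using sum_mono_inv[of "\<lambda>S. f (S, restrict x S)" C "\<lambda>S. Max (f ` scope_tuples D S)"] finC le
    by auto
  finally show ?thesis .
qed

text \<open>Spreading \<open>M\<close> evenly over the scopes makes both the objective and the bound
  constantly \<open>M\<close>. Without scopes every bound is the empty sum, so there only
  \<open>M = 0\<close> can be attained.\<close>

lemma exists_super_reparametrization_upper_bound:
  fixes g :: "('v, 'd) tuple \<Rightarrow> real"
  assumes "finite V" "finite D" "D \<noteq> {}" "C \<subseteq> Pow V" "g \<in> wcsps D C"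
    and M: "\<And>x. x \<in> V \<rightarrow>\<^sub>E D \<Longrightarrow> objective D C g x \<le> M"
    and "C = {} \<Longrightarrow> M = 0"
  shows "\<exists>h. super_reparametrization D V C h g \<and> upper_bound D C h = M"
proof -
  have finC: "finite C"
    using assms(1,4) by (meson finite_Pow_iff finite_subset)
  define h :: "('v, 'd) tuple \<Rightarrow> real" where "h = (\<lambda>t\<in>tuples D C. M / card C)"
  have h: "h t = M / card C" if "S \<in> C" "t \<in> scope_tuples D S" for S t
    using that by (auto simp: h_def tuples_def)
  \<comment> \<open>For empty \<open>C\<close> the sum is 0, which equals \<open>M\<close> by the
    last hypothesis; otherwise \<open>card C\<close> is nonzero and cancels.\<close>
  have total: "(\<Sum>S\<in>C. M / card C) = M"
    using finC assms(7) by (cases "C = {}") auto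
  have "objective D C h x = M" if "x \<in> V \<rightarrow>\<^sub>E D" for x
  proof -
    have "h (S, restrict x S) = M / card C" if "S \<in> C" for S
      using h that \<open>x \<in> V \<rightarrow>\<^sub>E D\<close> restrict_in_scope_tuples assms(4) by blast
    then have "objective D C h x = (\<Sum>S\<in>C. M / card C)"
      unfolding objective_eq_sum_scopes[OF assms(1,2,4) that] by (intro sum.cong) auto
    then show ?thesis
      using total by simp
  qed
  moreover have "h \<in> wcsps D C"
    by (simp add: h_def wcsps_def)
  ultimately have "super_reparametrization D V C h g"
    using assms(5) M by (simp add: super_reparametrization_def)
  moreover have "upper_bound D C h = M"
  proof -
    \<comment> \<open>Since \<open>D\<close> is nonempty, so is \<open>scope_tuples D S\<close>; the
      image is therefore a true singleton and its \<open>Max\<close> is the constant.\<close>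
    have "h ` scope_tuples D S = {M / card C}" if "S \<in> C" for S
      using h[OF that] scope_tuples_nonempty[OF assms(3), of S] by (auto simp: image_iff)
    then have "upper_bound D C h = (\<Sum>S\<in>C. M / card C)"
      by (simp add: upper_bound_def)
    then show ?thesis
      using total by simp
  qed
  ultimately show ?thesis by blast
qed

theorem theorem2:
  fixes V :: "'v set" and D :: "'d set" and C :: "'v set set"
    and f g :: "('v, 'd) tuple \<Rightarrow> real"
  assumes "finite V" and "finite D" and "D \<noteq> {}"
    and "C \<subseteq> Pow V" and "{} \<notin> C"
    and "g \<in> wcsps D C" and "f \<in> wcsps D C"
    and "super_reparametrization D V C f g"
  defines "a \<equiv> is_arg_min (upper_bound D C) (\<lambda>f'. super_reparametrization D V C f' g) f"
  defines "b \<equiv> upper_bound D C f = (MAX x \<in> V \<rightarrow>\<^sub>E D. objective D C f x) \<and>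
                (MAX x \<in> V \<rightarrow>\<^sub>E D. objective D C f x) = (MAX x \<in> V \<rightarrow>\<^sub>E D. objective D C g x)"
  defines "c \<equiv> \<exists>x. csp_solution D V C (active_tuples D C f) x \<and> objective D C f x = objective D C g x"
  shows "(a \<longleftrightarrow> b) \<and> (b \<longleftrightarrow> c)"
proof -
  define X where "X = V \<rightarrow>\<^sub>E D"
  define M where "M = (MAX x \<in> X. objective D C g x)"
  define F where "F = (MAX x \<in> X. objective D C f x)"
  have X: "finite X" "X \<noteq> {}"
    using assms(1-3) by (auto simp: X_def finite_PiE PiE_eq_empty_iff)
  have g_le: "objective D C g x \<le> M" if "x \<in> X" for x
    using X that by (simp add: M_def)
  have f_le: "objective D C f x \<le> F" if "x \<in> X" for x
    using X that by (simp add: F_def)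
  have "M \<in> objective D C g ` X" "F \<in> objective D C f ` X"
    unfolding M_def F_def using X by (intro Max_in; simp)+
  \<comment> \<open>The maximizer \<open>y\<close> of \<open>g\<close> yields the lower bound
    \<open>M\<close> below and later serves as the solution required by \<open>c\<close>.\<close>
  then obtain y z where y: "y \<in> X" "objective D C g y = M"
    and z: "z \<in> X" "objective D C f z = F"
    by auto
  have sr: "objective D C g x \<le> objective D C h x"
    if "super_reparametrization D V C h g" "x \<in> X" for h x
    using that by (simp add: super_reparametrization_def X_def)
  have ub: "objective D C h x \<le> upper_bound D C h" if "x \<in> X" for h x
    using that assms(1,2,4) by (auto simp: X_def intro: objective_le_upper_bound)
  have lower: "M \<le> upper_bound D C h" if "super_reparametrization D V C h g" for h
    using sr[OF that y(1)] ub[OF y(1), of h] y(2) by simp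
  have "M = 0" if "C = {}"
    using y(2) that by (simp add: objective_def tuples_def)
  then obtain h where h: "super_reparametrization D V C h g" "upper_bound D C h = M"
    using exists_super_reparametrization_upper_bound[OF assms(1-4,6), of M] g_le
    by (auto simp: X_def)
  \<comment> \<open>The feasible \<open>h\<close> attains the lower bound \<open>M\<close>, so
    \<open>M\<close> is the minimum and optimality of \<open>f\<close> means attaining it.\<close>
  have a: "a \<longleftrightarrow> upper_bound D C f = M"
    unfolding a_def is_arg_min_linorder
    using assms(8) h lower by (metis order_antisym)
  \<comment> \<open>In the chain from \<open>M\<close> through \<open>F\<close> to the bound, equal
    ends force both equalities of \<open>b\<close>.\<close>
  have "M \<le> F" "F \<le> upper_bound D C f"
    using sr[OF assms(8) y(1)] f_le[OF y(1)] y(2) ub[OF z(1), of f] z(2) by auto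
  then have b: "b \<longleftrightarrow> upper_bound D C f = M"
    unfolding b_def X_def[symmetric] M_def[symmetric] F_def[symmetric] by auto
  have "c \<longleftrightarrow> (\<exists>x\<in>X. objective D C f x = upper_bound D C f \<and> objective D C f x = objective D C g x)"
    unfolding c_def X_def
    using csp_solution_active_iff[OF assms(1,2,4), of _ f] by (auto simp: csp_solution_def)
  also have "\<dots> \<longleftrightarrow> upper_bound D C f = M"
  proof
    assume "upper_bound D C f = M"
    \<comment> \<open>The objective of \<open>f\<close> at \<open>y\<close> lies between
      \<open>M\<close>, the value of \<open>g\<close> there, and the bound, which is now also
      \<open>M\<close>.\<close>
    then have "objective D C f y = upper_bound D C f \<and> objective D C f y = objective D C g y"
      using sr[OF assms(8) y(1)] ub[OF y(1), of f] y(2) by simp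
    then show "\<exists>x\<in>X. objective D C f x = upper_bound D C f \<and> objective D C f x = objective D C g x"
      using y(1) by blast
  next
    assume "\<exists>x\<in>X. objective D C f x = upper_bound D C f \<and> objective D C f x = objective D C g x"
    \<comment> \<open>The bound equals a value of the objective of \<open>g\<close>, hence is at
      most \<open>M\<close>; \<open>lower\<close> gives the converse inequality.\<close>
    then show "upper_bound D C f = M"
      using g_le lower[OF assms(8)] by force
  qed
  finally show ?thesis
    using a b by simp
qed

end
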